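(* For every network $G=(V,E)$ with capacities $(u_e)_{e\in E}$, source $s$, sink $t$, and every integer $\Gamma$ with $1\le\Gamma\le|E|$, one has $Z_{\mathrm{RNI}}=Z_{\mathrm{ADP}}$, that is, $$\min_{\alpha\in\Delta(\Omega)}\ \max_{x\in\mathcal X}\ \sum_{\mu\in\Omega}\alpha(\mu)f(\mu,x)\;=\;\max_{x\in\mathcal X}\ \min_{\mu\in\Omega}\ f(\mu,x).$$
   Context: $G=(V,E)$ is a finite directed graph (parallel arcs allowed) with capacities $u_e\in\mathbb R_+$ for $e\in E$, and distinct nodes $s$ (source) and $t$ (sink); no arc enters $s$ and no arc leaves $t$. $\delta^+(v)$ and $\delta^-(v)$ denote the sets of arcs leaving and entering $v$. $\Gamma$ is an integer with $1\le\Gamma\le|E|$. An $s$-$t$-flow is $x:E\to\mathbb R_+$ with $x_e\le u_e$ for all $e\in E$ and $\sum_{e\in\delta^-(v)}x_e-\sum_{e\in\delta^+(v)}x_e=0$ for all $v\in V\setminus\{s,t\}$. $\mathcal X$ is the set of all $s$-$t$-flows, and $\mathrm{Val}(x):=\sum_{e\in\delta^-(t)}x_e$. $\Omega:=\{\mu\in\{0,1\}^{E}\mid\sum_{e\in E}\mu_e=\Gamma\}$ is the set of interdictor's pure strategies ($\mu_e=1$ means arc $e$ is removed). For $\mu\in\Omega$, $x\in\mathcal X$, the payoff is $$f(\mu,x):=\max\{\mathrm{Val}(y)\mid y\in\mathcal X,\ 0\le y_e\le x_e\ \text{for all } e \text{ with }\mu_e=0,\ y_e=0\ \text{for all } e\text{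 with }\mu_e=1\}.$$ $\Delta(\Omega)$ is the set of probability distributions $\alpha:\Omega\to[0,1]$ on $\Omega$. The optimal value of the (arc-based) randomized network interdiction problem is $Z_{\mathrm{RNI}}:=\min_{\alpha\in\Delta(\Omega)}\max_{x\in\mathcal X}\sum_{\mu\in\Omega}\alpha(\mu)f(\mu,x)$; the optimal value of the adaptive maximum flow problem is $Z_{\mathrm{ADP}}:=\max_{x\in\mathcal X}\min_{\mu\in\Omega}f(\mu,x)$. *)

theory Defs
  imports "HOL-Analysis.Analysis" "Graph_Theory.Digraph"
begin

text \<open>Vectors indexed by the arc set are extensional functions, so that a flow or an
  interdictor strategy is determined by its values on the arcs; in particular
  \<open>interdictions\<close> is a finite set.\<close>

definition flows :: "('v, 'e) pre_digraph \<Rightarrow> ('e \<Rightarrow> real) \<Rightarrow> 'v \<Rightarrow> 'v \<Rightarrow> ('e \<Rightarrow> real) set" where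
  "flows G u s t = {x \<in> arcs G \<rightarrow>\<^sub>E {0..}.
     (\<forall>e \<in> arcs G. x e \<le> u e) \<and>
     (\<forall>v \<in> verts G - {s, t}. (\<Sum>e \<in> in_arcs G v. x e) - (\<Sum>e \<in> out_arcs G v. x e) = 0)}"

definition flow_value :: "('v, 'e) pre_digraph \<Rightarrow> 'v \<Rightarrow> ('e \<Rightarrow> real) \<Rightarrow> real" where
  "flow_value G t x = (\<Sum>e \<in> in_arcs G t. x e)"

definition interdictions :: "('v, 'e) pre_digraph \<Rightarrow> nat \<Rightarrow> ('e \<Rightarrow> nat) set" where
  "interdictions G \<Gamma> = {\<mu> \<in> arcs G \<rightarrow>\<^sub>E {0, 1}. (\<Sum>e \<in> arcs G. \<mu> e) = \<Gamma>}"

definition residual_flows ::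
  "('v, 'e) pre_digraph \<Rightarrow> ('e \<Rightarrow> real) \<Rightarrow> 'v \<Rightarrow> 'v \<Rightarrow> ('e \<Rightarrow> nat) \<Rightarrow> ('e \<Rightarrow> real) \<Rightarrow> ('e \<Rightarrow> real) set" where
  "residual_flows G u s t \<mu> x = {y \<in> flows G u s t.
     (\<forall>e \<in> arcs G. \<mu> e = 0 \<longrightarrow> 0 \<le> y e \<and> y e \<le> x e) \<and>
     (\<forall>e \<in> arcs G. \<mu> e = 1 \<longrightarrow> y e = 0)}"

text \<open>Maxima and minima over infinite sets are written as suprema and infima;
  \<open>attains_max\<close> and \<open>attains_min\<close> state separately that they are attained.\<close>

definition attains_max :: "('a \<Rightarrow> real) \<Rightarrow> 'a set \<Rightarrow> bool" where
  "attains_max g A \<longleftrightarrow> (\<exists>a. is_arg_max g (\<lambda>x. x \<in> A) a)"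

definition attains_min :: "('a \<Rightarrow> real) \<Rightarrow> 'a set \<Rightarrow> bool" where
  "attains_min g A \<longleftrightarrow> (\<exists>a. is_arg_min g (\<lambda>x. x \<in> A) a)"

definition payoff ::
  "('v, 'e) pre_digraph \<Rightarrow> ('e \<Rightarrow> real) \<Rightarrow> 'v \<Rightarrow> 'v \<Rightarrow> ('e \<Rightarrow> nat) \<Rightarrow> ('e \<Rightarrow> real) \<Rightarrow> real" where
  "payoff G u s t \<mu> x = (SUP y \<in> residual_flows G u s t \<mu> x. flow_value G t y)"

definition distributions :: "'a set \<Rightarrow> ('a \<Rightarrow> real) set" where
  "distributions \<Omega> = {\<alpha> \<in> \<Omega> \<rightarrow>\<^sub>E {0..1}. (\<Sum>\<mu> \<in> \<Omega>. \<alpha> \<mu>) = 1}"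

definition expected_payoff ::
  "('v, 'e) pre_digraph \<Rightarrow> ('e \<Rightarrow> real) \<Rightarrow> 'v \<Rightarrow> 'v \<Rightarrow> nat \<Rightarrow> (('e \<Rightarrow> nat) \<Rightarrow> real) \<Rightarrow> ('e \<Rightarrow> real) \<Rightarrow> real" where
  "expected_payoff G u s t \<Gamma> \<alpha> x = (\<Sum>\<mu> \<in> interdictions G \<Gamma>. \<alpha> \<mu> * payoff G u s t \<mu> x)"

definition best_response_value ::
  "('v, 'e) pre_digraph \<Rightarrow> ('e \<Rightarrow> real) \<Rightarrow> 'v \<Rightarrow> 'v \<Rightarrow> nat \<Rightarrow> (('e \<Rightarrow> nat) \<Rightarrow> real) \<Rightarrow> real" where
  "best_response_value G u s t \<Gamma> \<alpha> = (SUP x \<in> flows G u s t. expected_payoff G u s t \<Gamma> \<alpha> x)"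

definition worst_case_payoff ::
  "('v, 'e) pre_digraph \<Rightarrow> ('e \<Rightarrow> real) \<Rightarrow> 'v \<Rightarrow> 'v \<Rightarrow> nat \<Rightarrow> ('e \<Rightarrow> real) \<Rightarrow> real" where
  "worst_case_payoff G u s t \<Gamma> x = Min ((\<lambda>\<mu>. payoff G u s t \<mu> x) ` interdictions G \<Gamma>)"

definition Z_RNI ::
  "('v, 'e) pre_digraph \<Rightarrow> ('e \<Rightarrow> real) \<Rightarrow> 'v \<Rightarrow> 'v \<Rightarrow> nat \<Rightarrow> real" where
  "Z_RNI G u s t \<Gamma> =
     (INF \<alpha> \<in> distributions (interdictions G \<Gamma>). best_response_value G u s t \<Gamma> \<alpha>)"

definition Z_ADP ::
  "('v, 'e) pre_digraph \<Rightarrow> ('e \<Rightarrow> real) \<Rightarrow> 'v \<Rightarrow> 'v \<Rightarrow> nat \<Rightarrow> real" where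
  "Z_ADP G u s t \<Gamma> = (SUP x \<in> flows G u s t. worst_case_payoff G u s t \<Gamma> x)"

end

theory Submission
  imports Defs
begin

text \<open>Each payoff \<open>f(\<mu>, \<cdot>)\<close> is concave on the convex set of flows, because convex combinations of
  residual flows are residual flows. By Fan's theorem of the alternative, if no flow has all payoffs
  above \<open>v = Z_ADP\<close>, then some convex combination of the finitely many payoff functions is bounded
  by \<open>v\<close> on all flows; its weights are an optimal mixed strategy of the interdictor.
  The alternative is proved by induction on the number of functions: restricting to the points where
  the last function exceeds \<open>v\<close> reduces it to two functions, where a line in the plane separates.
  Instead of continuity of the payoff, attainment of the maxima over \<open>x\<close> uses compactness of the
  set of pairs of a flow \<open>x\<close> and a family of residual flows of \<open>x\<close>.\<close>

section \<open>Fan's theorem of the alternative\<close>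

text \<open>No linear structure on \<open>X\<close> is assumed: one point \<open>z\<close> has to
  dominate the combination for all indices at once. This form survives both restricting to a
  superlevel set of one function and averaging the functions.\<close>

definition concavelike :: "('i \<Rightarrow> 'x \<Rightarrow> real) \<Rightarrow> 'i set \<Rightarrow> 'x set \<Rightarrow> bool" where
  "concavelike f I X \<longleftrightarrow> (\<forall>x\<in>X. \<forall>y\<in>X. \<forall>c\<in>{0..1}. \<exists>z\<in>X. \<forall>i\<in>I. c * f i x + (1 - c) * f i y \<le> f i z)"

lemma concavelikeD:
  assumes "concavelike f I X" "x \<in> X" "y \<in> X" "0 \<le> c" "c \<le> 1"
  obtains z where "z \<in> X" "\<And>i. i \<in> I \<Longrightarrow> c * f i x + (1 - c) * f i y \<le> f i z"
  using assms unfolding concavelike_def by (meson atLeastAtMost_iff)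

text \<open>The points dominated by some \<open>(g x, h x)\<close> form a convex set that misses the
  open quadrant above \<open>(v, v)\<close>. A separating line has a nonnegative normal because the
  quadrant is unbounded in both directions; normalized, it gives the weights.\<close>

lemma concavelike_alternative_two:
  fixes g h :: "'x \<Rightarrow> real"
  assumes cc: "\<And>x y c. x \<in> X \<Longrightarrow> y \<in> X \<Longrightarrow> 0 \<le> c \<Longrightarrow> c \<le> 1 \<Longrightarrow>
      \<exists>z\<in>X. c * g x + (1 - c) * g y \<le> g z \<and> c * h x + (1 - c) * h y \<le> h z"
    and le: "\<And>x. x \<in> X \<Longrightarrow> g x \<le> v \<or> h x \<le> v"
  obtains p q where "0 \<le> p" "0 \<le> q" "p + q = 1" "\<And>x. x \<in> X \<Longrightarrow> p * g x + q * h x \<le> v"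
proof (cases "X = {}")
  case True
  then show ?thesis using that[of 1 0] by simp
next
  case False
  \<comment> \<open>The downward closure of the image is taken because the image itself need not be
    convex: \<open>cc\<close> yields only inequalities.\<close>
  define S where "S = {w. \<exists>x\<in>X. fst w \<le> g x \<and> snd w \<le> h x}"
  define T where "T = {w :: real \<times> real. v < fst w \<and> v < snd w}"
  have "convex S"
  proof (rule convexI)
    fix w w' :: "real \<times> real" and a b :: real
    assume w: "w \<in> S" "w' \<in> S" and ab: "0 \<le> a" "0 \<le> b" "a + b = 1"
    from w obtain x x' where x: "x \<in> X" "fst w \<le> g x" "snd w \<le> h x"
      and x': "x' \<in> X" "fst w' \<le> g x'" "snd w' \<le> h x'"
      unfolding S_def by auto
    have b: "b = 1 - a" using ab by simp
    obtain z where z: "z \<in> X" "a * g x + b * g x' \<le> g z" "a * h x + b * h x' \<le> h z"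
      using cc[of x x' a] x(1) x'(1) ab b by auto
    have "a * fst w + b * fst w' \<le> a * g x + b * g x'" "a * snd w + b * snd w' \<le> a * h x + b * h x'"
      using x x' ab by (intro add_mono mult_left_mono; simp)+
    with z show "a *\<^sub>R w + b *\<^sub>R w' \<in> S"
      unfolding S_def by (auto intro!: bexI[of _ z])
  qed
  moreover have "convex T"
  proof -
    have "T = {v<..} \<times> {v<..}" by (auto simp: T_def)
    then show ?thesis by (simp add: convex_Times)
  qed
  moreover have "S \<inter> T = {}" using le unfolding S_def T_def by force
  moreover have "S \<noteq> {}" using False unfolding S_def by force
  moreover have "(v + 1, v + 1) \<in> T" by (simp add: T_def)
  ultimately obtain a b where ab: "a \<noteq> 0" "\<And>w. w \<in> S \<Longrightarrow> a \<bullet> w \<le> b" "\<And>w. w \<in> T \<Longrightarrow> b \<le> a \<bullet> w"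
    using separating_hyperplane_sets[of S T] by (metis empty_iff)
  obtain p q where a: "a = (p, q)" by (cases a)
  have T: "b \<le> p * r + q * r'" if "v < r" "v < r'" for r r'
    using ab(3)[of "(r, r')"] that by (simp add: T_def a)
  have S: "p * g x + q * h x \<le> b" if "x \<in> X" for x
    using ab(2)[of "(g x, h x)"] that by (auto simp add: S_def a)
  \<comment> \<open>A linear function bounded below on the positive half-line has nonnegative slope:
    otherwise the \<open>k\<close> below makes \<open>c * k\<close> smaller than \<open>d\<close>.
    It is applied to points of \<open>T\<close> going to infinity in one coordinate.\<close>
  have nonneg: "0 \<le> c" if "\<And>k. 0 < k \<Longrightarrow> d \<le> c * k" for c d :: real
  proof (rule ccontr)
    assume "\<not> 0 \<le> c"
    then have c: "c < 0" by simp
    define k where "k = (\<bar>d\<bar> + 1) / (- c)"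
    have "0 < k" "c * k = - (\<bar>d\<bar> + 1)" using c by (auto simp: k_def field_simps)
    with that[of k] show False by linarith
  qed
  have p: "0 \<le> p"
  proof (rule nonneg)
    fix k :: real assume "0 < k"
    then show "b - (p * v + q * (v + 1)) \<le> p * k"
      using T[of "v + k" "v + 1"] by (simp add: algebra_simps)
  qed
  have q: "0 \<le> q"
  proof (rule nonneg)
    fix k :: real assume "0 < k"
    then show "b - (p * (v + 1) + q * v) \<le> q * k"
      using T[of "v + 1" "v + k"] by (simp add: algebra_simps)
  qed
  have pq: "0 < p + q" using p q ab(1) a by (auto simp: zero_prod_def less_le add_nonneg_eq_0_iff)
  \<comment> \<open>The corner \<open>(v, v)\<close> is not in the open quadrant, so it is
    approached along the diagonal; the increment \<open>e / (p + q)\<close> raises the functional by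
    exactly \<open>e\<close>.\<close>
  have b: "b \<le> (p + q) * v"
  proof (rule field_le_epsilon)
    fix e :: real assume e: "0 < e"
    have "b \<le> p * (v + e / (p + q)) + q * (v + e / (p + q))"
      using e pq by (intro T) auto
    also have "\<dots> = (p + q) * (v + e / (p + q))" by (rule distrib_right[symmetric])
    also have "\<dots> = (p + q) * v + e" using pq by (simp add: distrib_left)
    finally show "b \<le> (p + q) * v + e" .
  qed
  show ?thesis
  proof (rule that[of "p / (p + q)" "q / (p + q)"])
    fix x assume "x \<in> X"
    then have "p * g x + q * h x \<le> v * (p + q)"
      using order_trans[OF S b] by (simp add: mult.commute)
    then have "(p * g x + q * h x) / (p + q) \<le> v" using pq by (simp only: pos_divide_le_eq)
    then show "p / (p + q) * g x + q / (p + q) * h x \<le> v"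
      by (simp only: times_divide_eq_left add_divide_distrib)
  next
    show "p / (p + q) + q / (p + q) = 1"
      using pq by (simp only: add_divide_distrib[symmetric] divide_self_if) simp
  qed (use p q in simp_all)
qed

text \<open>The weights \<open>b\<close> for \<open>I\<close> come from the points where
  \<open>f i\<close> exceeds \<open>v\<close>; the averaged function \<open>h\<close> and
  \<open>f i\<close> then fall under the case of two functions on all of \<open>X\<close>. The
  induction therefore has to vary \<open>X\<close>.\<close>

theorem concavelike_alternative:
  fixes f :: "'i \<Rightarrow> 'x \<Rightarrow> real"
  assumes "finite I" "I \<noteq> {}" "concavelike f I X" "\<And>x. x \<in> X \<Longrightarrow> \<exists>i\<in>I. f i x \<le> v"
  shows "\<exists>a. (\<forall>i\<in>I. 0 \<le> a i) \<and> sum a I = 1 \<and> (\<forall>x\<in>X. (\<Sum>i\<in>I. a i * f i x) \<le> v)"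
  using assms
proof (induction I arbitrary: X rule: finite_ne_induct)
  case (singleton i)
  then show ?case by (intro exI[of _ "\<lambda>_. 1"]) auto
next
  case (insert i I)
  define X' where "X' = {x\<in>X. v < f i x}"
  have "concavelike f I X'"
    unfolding concavelike_def
  proof (intro ballI)
    fix x y c assume xy: "x \<in> X'" "y \<in> X'" and c: "c \<in> {0..1::real}"
    then obtain z where z: "z \<in> X" "\<And>j. j \<in> insert i I \<Longrightarrow> c * f j x + (1 - c) * f j y \<le> f j z"
      using concavelikeD[OF insert.prems(1), of x y c] by (auto simp: X'_def)
    \<comment> \<open>An open ray is convex, so the strict bound passes to \<open>z\<close>, which
      therefore stays in \<open>X'\<close>.\<close>
    have "v < c * f i x + (1 - c) * f i y"
      using convexD[OF convex_real_interval(3)[of v], of "f i x" "f i y" c "1 - c"] xy c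
      by (simp add: X'_def)
    with z show "\<exists>z\<in>X'. \<forall>j\<in>I. c * f j x + (1 - c) * f j y \<le> f j z"
      unfolding X'_def by (intro bexI[of _ z] CollectI conjI ballI) (auto intro: less_le_trans)
  qed
  moreover have "\<exists>j\<in>I. f j x \<le> v" if "x \<in> X'" for x
    using insert.prems(2)[of x] that by (auto simp: X'_def)
  ultimately obtain b where b: "\<And>j. j \<in> I \<Longrightarrow> 0 \<le> b j" "sum b I = 1"
    "\<And>x. x \<in> X' \<Longrightarrow> (\<Sum>j\<in>I. b j * f j x) \<le> v"
    using insert.IH[of X'] by auto
  define h where "h x = (\<Sum>j\<in>I. b j * f j x)" for x
  obtain p q where pq: "0 \<le> p" "0 \<le> q" "p + q = 1" "\<And>x. x \<in> X \<Longrightarrow> p * h x + q * f i x \<le> v"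
  proof (rule concavelike_alternative_two[of X h "f i" v])
    fix x y c assume "x \<in> X" "y \<in> X" "0 \<le> c" "c \<le> (1::real)"
    then obtain z where z: "z \<in> X" "\<And>j. j \<in> insert i I \<Longrightarrow> c * f j x + (1 - c) * f j y \<le> f j z"
      using concavelikeD[OF insert.prems(1), of x y c] by auto
    have "c * h x + (1 - c) * h y = (\<Sum>j\<in>I. b j * (c * f j x + (1 - c) * f j y))"
      unfolding h_def sum_distrib_left sum.distrib[symmetric]
      by (intro sum.cong refl) (simp add: algebra_simps)
    also have "\<dots> \<le> h z"
      unfolding h_def using b(1) z by (intro sum_mono mult_left_mono) auto
    finally show "\<exists>z\<in>X. c * h x + (1 - c) * h y \<le> h z \<and> c * f i x + (1 - c) * f i y \<le> f i z"
      using z by auto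
  next
    \<comment> \<open>A point outside \<open>X'\<close> has \<open>f i x \<le> v\<close>; on
      \<open>X'\<close> the induction hypothesis bounds \<open>h\<close>.\<close>
    show "h x \<le> v \<or> f i x \<le> v" if "x \<in> X" for x
      using b(3)[of x] that by (auto simp: X'_def h_def)
  qed auto
  \<comment> \<open>Mass \<open>q\<close> goes to the new index; the remaining mass \<open>p\<close>
    is spread over \<open>I\<close> in proportion to \<open>b\<close>.\<close>
  define a where "a j = (if j = i then q else p * b j)" for j
  have I: "(\<Sum>j\<in>I. a j * g j) = p * (\<Sum>j\<in>I. b j * g j)" for g
    unfolding sum_distrib_left
  proof (rule sum.cong)
    fix j assume "j \<in> I"
    then show "a j * g j = p * (b j * g j)" using insert.hyps by (auto simp: a_def)
  qed simp
  have "sum a (insert i I) = 1"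
    using I[of "\<lambda>_. 1"] insert.hyps b(2) pq(3) by (simp add: a_def)
  moreover have "(\<Sum>j\<in>insert i I. a j * f j x) \<le> v" if "x \<in> X" for x
    using I[of "\<lambda>j. f j x"] insert.hyps pq(4)[OF that] by (simp add: a_def h_def)
  moreover have "\<forall>j\<in>insert i I. 0 \<le> a j"
    using b(1) pq by (auto simp: a_def)
  ultimately show ?case by blast
qed

section \<open>Compactness and attainment\<close>

text \<open>Tychonoff's theorem, carried over to the topology of the function type.\<close>

lemma compact_Pi_UNIV:
  fixes S :: "'a \<Rightarrow> 'b::topological_space set"
  assumes "\<And>i. compact (S i)"
  shows "compact (Pi UNIV S)"
proof -
  have "compactin (product_topology (\<lambda>i. euclidean) UNIV) (PiE UNIV S)"
    using assms by (subst compactin_PiE) auto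
  then show ?thesis
    by (simp add: euclidean_product_topology PiE_UNIV_domain)
qed

text \<open>Extensionality amounts to a one-point factor \<open>{undefined}\<close> at every index
  outside \<open>I\<close>, so this is again a full product of compact sets.\<close>

lemma compact_PiE:
  fixes S :: "'a \<Rightarrow> 'b::topological_space set"
  assumes "\<And>i. i \<in> I \<Longrightarrow> compact (S i)"
  shows "compact (PiE I S)"
proof -
  have "PiE I S = Pi UNIV (\<lambda>i. if i \<in> I then S i else {undefined})"
    by (auto simp: PiE_iff extensional_def Pi_iff split: if_splits)
  then show ?thesis
    using assms by (auto intro!: compact_Pi_UNIV)
qed

lemma attains_maxI: "a \<in> A \<Longrightarrow> (\<And>x. x \<in> A \<Longrightarrow> g x \<le> g a) \<Longrightarrow> attains_max g A"
  unfolding attains_max_def is_arg_max_def by (meson not_le)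

lemma attains_minI: "a \<in> A \<Longrightarrow> (\<And>x. x \<in> A \<Longrightarrow> g a \<le> g x) \<Longrightarrow> attains_min g A"
  unfolding attains_min_def is_arg_min_def by (meson not_le)

lemma attains_maxE:
  assumes "attains_max g A"
  obtains a where "a \<in> A" "\<And>x. x \<in> A \<Longrightarrow> g x \<le> g a" "(SUP x\<in>A. g x) = g a"
proof -
  obtain a where a: "a \<in> A" "\<And>x. x \<in> A \<Longrightarrow> g x \<le> g a"
    using assms unfolding attains_max_def is_arg_max_def by (auto simp: not_less)
  then show ?thesis
    by (intro that) (auto intro!: cSup_eq_maximum)
qed

text \<open>Makes the worst case over interdictions a continuous function of the vector of
  payoffs.\<close>

lemma continuous_on_Min_coordinates:
  assumes "finite I" "I \<noteq> {}"
  shows "continuous_on UNIV (\<lambda>w :: 'i \<Rightarrow> real. Min (w ` I))"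
  using assms
proof (induction I rule: finite_ne_induct)
  case (insert i I)
  then have "(\<lambda>w :: 'i \<Rightarrow> real. Min (w ` insert i I)) = (\<lambda>w. min (w i) (Min (w ` I)))"
    by simp
  then show ?case
    using insert.IH by (simp only:) (intro continuous_on_min continuous_on_product_coordinates)
qed simp

section \<open>Flows in a network\<close>

lemma closed_flow_conservation:
  assumes "\<And>e. continuous_on UNIV (\<lambda>p. x p e :: real)"
  shows "closed {p. \<forall>v\<in>V. (\<Sum>e\<in>A v. x p e) - (\<Sum>e\<in>B v. x p e) = 0}"
  unfolding Ball_def
  by (intro closed_Collect_all closed_Collect_imp closed_Collect_eq open_Collect_const
      continuous_on_diff continuous_on_sum continuous_on_const assms)

context
  fixes G :: "('v, 'e) pre_digraph" and u :: "'e \<Rightarrow> real" and s t :: 'v and \<Gamma> :: nat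
  assumes fin: "finite (arcs G)" and u_nonneg: "\<forall>e\<in>arcs G. 0 \<le> u e"
begin

section \<open>Convex combinations of flows\<close>

text \<open>The restriction keeps the combination extensional, as membership in \<open>flows\<close>
  demands.\<close>

definition mix :: "real \<Rightarrow> ('e \<Rightarrow> real) \<Rightarrow> ('e \<Rightarrow> real) \<Rightarrow> 'e \<Rightarrow> real" where
  "mix c x y = restrict (\<lambda>e. c * x e + (1 - c) * y e) (arcs G)"

lemma sum_mix:
  assumes "A \<subseteq> arcs G"
  shows "(\<Sum>e\<in>A. mix c x y e) = c * (\<Sum>e\<in>A. x e) + (1 - c) * (\<Sum>e\<in>A. y e)"
proof -
  have "(\<Sum>e\<in>A. mix c x y e) = (\<Sum>e\<in>A. c * x e + (1 - c) * y e)"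
    using assms by (intro sum.cong) (auto simp: mix_def)
  then show ?thesis by (simp add: sum.distrib sum_distrib_left)
qed

lemma in_arcs_subset: "in_arcs G v \<subseteq> arcs G" and out_arcs_subset: "out_arcs G v \<subseteq> arcs G"
  by (auto simp: in_arcs_def out_arcs_def)

lemma convex_combination_le:
  assumes "0 \<le> c" "c \<le> (1::real)" "a \<le> a'" "b \<le> b'"
  shows "c * a + (1 - c) * b \<le> c * a' + (1 - c) * b'"
  using assms by (intro add_mono mult_left_mono) auto

lemma mix_flow:
  assumes x: "x \<in> flows G u s t" and y: "y \<in> flows G u s t" and c: "0 \<le> c" "c \<le> 1"
  shows "mix c x y \<in> flows G u s t"
  unfolding flows_def
proof (intro CollectI conjI ballI)
  show "mix c x y \<in> arcs G \<rightarrow>\<^sub>E {0..}"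
    using x y c by (auto simp: mix_def flows_def intro!: add_nonneg_nonneg mult_nonneg_nonneg)
  show "mix c x y e \<le> u e" if "e \<in> arcs G" for e
    using convex_combination_le[OF c, of "x e" "u e" "y e" "u e"] x y that
    by (simp add: mix_def flows_def algebra_simps)
  fix v assume "v \<in> verts G - {s, t}"
  then have "(\<Sum>e\<in>in_arcs G v. x e) = (\<Sum>e\<in>out_arcs G v. x e)"
    "(\<Sum>e\<in>in_arcs G v. y e) = (\<Sum>e\<in>out_arcs G v. y e)"
    using x y by (auto simp: flows_def)
  then show "(\<Sum>e\<in>in_arcs G v. mix c x y e) - (\<Sum>e\<in>out_arcs G v. mix c x y e) = 0"
    by (simp add: sum_mix in_arcs_subset out_arcs_subset)
qed

text \<open>For fixed \<mu> the constraints are linear in the pair of residual flow and flow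
  together, so both can be mixed with the same coefficient.\<close>

lemma mix_residual_flow:
  assumes x: "x \<in> residual_flows G u s t \<mu> x'" and y: "y \<in> residual_flows G u s t \<mu> y'"
    and c: "0 \<le> c" "c \<le> 1"
  shows "mix c x y \<in> residual_flows G u s t \<mu> (mix c x' y')"
  using x y mix_flow[of x y c] convex_combination_le[OF c] c
  by (auto simp: residual_flows_def mix_def)

lemma flow_value_mix: "flow_value G t (mix c x y) = c * flow_value G t x + (1 - c) * flow_value G t y"
  by (simp add: flow_value_def sum_mix in_arcs_subset)

section \<open>Compactness of the flow set and attainment of the inner maximum\<close>

text \<open>Sign and capacity bounds give a product of compact intervals, from which conservation
  cuts out a closed subset.\<close>

lemma compact_flows: "compact (flows G u s t)"
proof -
  have "flows G u s t = (\<Pi>\<^sub>E e\<in>arcs G. {0..u e}) \<inter>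
      {x. \<forall>v \<in> verts G - {s, t}. (\<Sum>e \<in> in_arcs G v. x e) - (\<Sum>e \<in> out_arcs G v. x e) = 0}"
    by (auto simp: flows_def PiE_iff extensional_def)
  then show ?thesis
    by (simp only:) (intro compact_Int_closed compact_PiE closed_flow_conservation
      compact_Icc continuous_on_product_coordinates)
qed

lemma zero_flow: "restrict (\<lambda>_. 0) (arcs G) \<in> flows G u s t"
proof -
  have "(\<Sum>e\<in>A. restrict (\<lambda>_. 0) (arcs G) e) = (0::real)" if "A \<subseteq> arcs G" for A
    using that by (intro sum.neutral) auto
  then show ?thesis
    using u_nonneg in_arcs_subset out_arcs_subset by (auto simp: flows_def)
qed

lemma residual_flows_iff:
  "y \<in> residual_flows G u s t \<mu> x \<longleftrightarrow> y \<in> flows G u s t \<and>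
    (\<forall>e\<in>arcs G. (\<mu> e = 0 \<longrightarrow> 0 \<le> y e \<and> y e \<le> x e) \<and> (\<mu> e = 1 \<longrightarrow> y e = 0))"
  by (auto simp: residual_flows_def)

lemma zero_residual_flow:
  assumes "x \<in> flows G u s t"
  shows "restrict (\<lambda>_. 0) (arcs G) \<in> residual_flows G u s t \<mu> x"
  using assms zero_flow by (auto simp: residual_flows_iff flows_def PiE_iff)

text \<open>Both vectors depend on a parameter \<open>p\<close>, so that the lemma serves a fixed
  \<open>x\<close> with varying \<open>y\<close> as well as \<open>x\<close> and \<open>y\<close>
  varying together. The premises on \<mu> do not depend on \<open>p\<close>, so the implications
  remain closed conditions.\<close>

lemma closed_residual_constraints:
  fixes x y :: "'p::topological_space \<Rightarrow> 'e \<Rightarrow> real" and \<mu> :: "'e \<Rightarrow> nat"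
  assumes "\<And>e. continuous_on UNIV (\<lambda>p. x p e)" "\<And>e. continuous_on UNIV (\<lambda>p. y p e)"
  shows "closed {p. \<forall>e\<in>arcs G. (\<mu> e = 0 \<longrightarrow> 0 \<le> y p e \<and> y p e \<le> x p e) \<and> (\<mu> e = 1 \<longrightarrow> y p e = 0)}"
  unfolding Ball_def using assms
  by (intro closed_Collect_all closed_Collect_imp closed_Collect_conj closed_Collect_eq
      closed_Collect_le open_Collect_const continuous_on_const) auto

lemma attains_max_residual:
  assumes "x \<in> flows G u s t"
  shows "attains_max (flow_value G t) (residual_flows G u s t \<mu> x)"
proof -
  let ?R = "residual_flows G u s t \<mu> x"
  have "?R = flows G u s t \<inter>
      {y. \<forall>e\<in>arcs G. (\<mu> e = 0 \<longrightarrow> 0 \<le> y e \<and> y e \<le> x e) \<and> (\<mu> e = 1 \<longrightarrow> y e = 0)}"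
    by (auto simp: residual_flows_iff)
  then have "compact ?R"
    using closed_residual_constraints[of "\<lambda>_. x" "\<lambda>y. y" \<mu>]
    by (simp add: compact_Int_closed compact_flows)
  moreover have "?R \<noteq> {}" using zero_residual_flow[OF assms] by blast
  moreover have "continuous_on ?R (flow_value G t)"
    unfolding flow_value_def
    by (rule continuous_on_subset[where s = UNIV]) (auto intro!: continuous_on_sum)
  ultimately obtain y where "y \<in> ?R" "\<forall>z\<in>?R. flow_value G t z \<le> flow_value G t y"
    using continuous_attains_sup[of ?R "flow_value G t"] by blast
  then show ?thesis by (intro attains_maxI[of y]) auto
qed

section \<open>Payoffs and their concavity\<close>

lemma flow_value_le_payoff:
  assumes "x \<in> flows G u s t" "y \<in> residual_flows G u s t \<mu> x"
  shows "flow_value G t y \<le> payoff G u s t \<mu> x"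
  using attains_maxE[OF attains_max_residual[OF assms(1), of \<mu>]] assms(2)
  unfolding payoff_def by metis

lemma payoff_eq_flow_value:
  assumes "x \<in> flows G u s t"
  obtains y where "y \<in> residual_flows G u s t \<mu> x" "payoff G u s t \<mu> x = flow_value G t y"
  using attains_maxE[OF attains_max_residual[OF assms, of \<mu>]] unfolding payoff_def by metis

text \<open>Mixing optimal residual flows of \<open>x\<close> and \<open>y\<close> gives a feasible
  residual flow of \<open>mix c x y\<close>. This witness does not depend on \<mu>, as
  \<open>concavelike\<close> requires.\<close>

lemma concavelike_payoff: "concavelike (payoff G u s t) I (flows G u s t)"
  unfolding concavelike_def
proof (intro ballI)
  fix x y c assume xy: "x \<in> flows G u s t" "y \<in> flows G u s t" and c: "c \<in> {0..1::real}"
  have "c * payoff G u s t \<mu> x + (1 - c) * payoff G u s t \<mu> y \<le> payoff G u s t \<mu> (mix c x y)" for \<mu>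
  proof -
    obtain x' y' where x': "x' \<in> residual_flows G u s t \<mu> x" "payoff G u s t \<mu> x = flow_value G t x'"
      and y': "y' \<in> residual_flows G u s t \<mu> y" "payoff G u s t \<mu> y = flow_value G t y'"
      using xy payoff_eq_flow_value by metis
    have "flow_value G t (mix c x' y') \<le> payoff G u s t \<mu> (mix c x y)"
      using xy c x' y' by (intro flow_value_le_payoff mix_flow mix_residual_flow) auto
    then show ?thesis by (simp add: flow_value_mix x' y')
  qed
  then show "\<exists>z\<in>flows G u s t. \<forall>\<mu>\<in>I. c * payoff G u s t \<mu> x + (1 - c) * payoff G u s t \<mu> y
      \<le> payoff G u s t \<mu> z"
    using mix_flow[of x y c] xy c by auto
qed

section \<open>Attainment of the maxima over flows\<close>

text \<open>Treats expected and worst-case payoff together. The inner maximizations are merged with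
  the outer one: by monotonicity of \<Phi>, it suffices to maximize the continuous \<Psi> over flows
  paired with one residual flow for each \<mu>.\<close>

lemma attains_max_payoffs:
  fixes \<Phi> :: "(('e \<Rightarrow> nat) \<Rightarrow> real) \<Rightarrow> real"
  assumes cont: "continuous_on UNIV \<Phi>"
    and mono: "\<And>w w'. (\<And>\<mu>. \<mu> \<in> I \<Longrightarrow> w \<mu> \<le> w' \<mu>) \<Longrightarrow> \<Phi> w \<le> \<Phi> w'"
  shows "attains_max (\<lambda>x. \<Phi> (\<lambda>\<mu>. payoff G u s t \<mu> x)) (flows G u s t)"
proof -
  define \<Psi> where "\<Psi> p = \<Phi> (\<lambda>\<mu>. flow_value G t (snd p \<mu>))"
    for p :: "('e \<Rightarrow> real) \<times> (('e \<Rightarrow> nat) \<Rightarrow> 'e \<Rightarrow> real)"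
  define K where "K = (flows G u s t \<times> (\<Pi>\<^sub>E \<mu>\<in>I. flows G u s t)) \<inter>
    {p. \<forall>\<mu>\<in>I. \<forall>e\<in>arcs G. (\<mu> e = 0 \<longrightarrow> 0 \<le> snd p \<mu> e \<and> snd p \<mu> e \<le> fst p e)
        \<and> (\<mu> e = 1 \<longrightarrow> snd p \<mu> e = 0)}"
  have K: "(x, Y) \<in> K \<longleftrightarrow> x \<in> flows G u s t \<and> Y \<in> extensional I \<and>
      (\<forall>\<mu>\<in>I. Y \<mu> \<in> residual_flows G u s t \<mu> x)" for x Y
    by (simp add: K_def residual_flows_iff PiE_iff ball_conj_distrib conj_ac)
  have c1: "continuous_on UNIV (\<lambda>p :: ('e \<Rightarrow> real) \<times> (('e \<Rightarrow> nat) \<Rightarrow> 'e \<Rightarrow> real). fst p e)" for e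
    by (rule continuous_on_product_then_coordinatewise) (rule continuous_on_fst[OF continuous_on_id])
  have c2: "continuous_on UNIV (\<lambda>p :: ('e \<Rightarrow> real) \<times> (('e \<Rightarrow> nat) \<Rightarrow> 'e \<Rightarrow> real). snd p \<mu> e)" for \<mu> e
    by (rule continuous_on_product_then_coordinatewise[OF
          continuous_on_product_then_coordinatewise[OF continuous_on_snd[OF continuous_on_id]]])
  have "compact K"
    unfolding K_def
    \<comment> \<open>Only the quantifier over \<mu> is unfolded; for each \<mu> the condition on
      all arcs is already known to be closed.\<close>
    by (subst Ball_def, intro compact_Int_closed compact_Times compact_flows compact_PiE
        closed_Collect_all closed_Collect_imp)
      (rule open_Collect_const closed_residual_constraints c1 c2)+
  moreover have "K \<noteq> {}"
  proof -
    have "(restrict (\<lambda>_. 0) (arcs G), \<lambda>\<mu>\<in>I. restrict (\<lambda>_. 0) (arcs G)) \<in> K"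
      using zero_flow zero_residual_flow[OF zero_flow] by (simp add: K)
    then show ?thesis by blast
  qed
  moreover have "continuous_on K \<Psi>"
    unfolding \<Psi>_def flow_value_def
    by (rule continuous_on_compose2[OF cont _ subset_UNIV],
        intro continuous_on_coordinatewise_then_product continuous_on_sum
        continuous_on_subset[OF c2] subset_UNIV)
  ultimately obtain m where "m \<in> K" "\<forall>p\<in>K. \<Psi> p \<le> \<Psi> m"
    using continuous_attains_sup[of K \<Psi>] by blast
  then obtain x Y where xY: "(x, Y) \<in> K" and max: "\<And>p. p \<in> K \<Longrightarrow> \<Psi> p \<le> \<Psi> (x, Y)"
    by (cases m) auto
  show ?thesis
  proof (rule attains_maxI[of x])
    show x: "x \<in> flows G u s t" using xY K by simp
    fix z assume z: "z \<in> flows G u s t"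
    have "\<exists>y. y \<in> residual_flows G u s t \<mu> z \<and> payoff G u s t \<mu> z = flow_value G t y" for \<mu>
      by (rule payoff_eq_flow_value[OF z]) blast
    then obtain Z where Z: "\<And>\<mu>. Z \<mu> \<in> residual_flows G u s t \<mu> z"
      "\<And>\<mu>. payoff G u s t \<mu> z = flow_value G t (Z \<mu>)"
      by metis
    \<comment> \<open>Optimal residual flows of \<open>z\<close> give a point of \<open>K\<close>
      whose values are the payoffs of \<open>z\<close>. The values of \<open>Y\<close> are at most
      the payoffs of \<open>x\<close>. Agreement on \<open>I\<close> is enough, since
      \<open>mono\<close> compares only there.\<close>
    have "\<Phi> (\<lambda>\<mu>. payoff G u s t \<mu> z) \<le> \<Psi> (z, restrict Z I)"
      unfolding \<Psi>_def by (rule mono) (simp add: Z)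
    also have "\<dots> \<le> \<Psi> (x, Y)"
      using z Z by (intro max) (simp add: K)
    also have "\<dots> \<le> \<Phi> (\<lambda>\<mu>. payoff G u s t \<mu> x)"
      unfolding \<Psi>_def using xY x by (intro mono) (simp add: K flow_value_le_payoff)
    finally show "\<Phi> (\<lambda>\<mu>. payoff G u s t \<mu> z) \<le> \<Phi> (\<lambda>\<mu>. payoff G u s t \<mu> x)" .
  qed
qed

text \<open>Nonnegative probabilities make the weighted sum monotone in the payoffs.\<close>

lemma attains_max_expected_payoff:
  assumes "\<alpha> \<in> distributions (interdictions G \<Gamma>)"
  shows "attains_max (expected_payoff G u s t \<Gamma> \<alpha>) (flows G u s t)"
  unfolding expected_payoff_def
  by (rule attains_max_payoffs[where \<Phi> = "\<lambda>w. \<Sum>\<mu>\<in>interdictions G \<Gamma>. \<alpha> \<mu> * w \<mu>"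
        and I = "interdictions G \<Gamma>"])
    (use assms in \<open>auto simp: distributions_def PiE_iff
      intro!: sum_mono mult_left_mono continuous_on_sum continuous_on_mult\<close>)

lemma finite_interdictions: "finite (interdictions G \<Gamma>)"
proof -
  have "finite (arcs G \<rightarrow>\<^sub>E {0, 1::nat})" using fin by (intro finite_PiE) auto
  then show ?thesis by (rule rev_finite_subset) (auto simp: interdictions_def)
qed

lemma interdictions_nonempty:
  assumes "\<Gamma> \<le> card (arcs G)"
  shows "interdictions G \<Gamma> \<noteq> {}"
proof -
  obtain A where A: "A \<subseteq> arcs G" "card A = \<Gamma>"
    using assms by (meson obtain_subset_with_card_n)
  have "(\<Sum>e\<in>arcs G. if e \<in> A then 1 else 0 :: nat) = card A"
    using A fin by (simp add: sum.If_cases Int_absorb1)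
  \<comment> \<open>The indicator of a set of \<Gamma> arcs is a pure strategy.\<close>
  then have "(\<lambda>e\<in>arcs G. if e \<in> A then 1 else 0) \<in> interdictions G \<Gamma>"
    using A by (auto simp: interdictions_def)
  then show ?thesis by blast
qed

lemma attains_max_worst_case_payoff:
  assumes "\<Gamma> \<le> card (arcs G)"
  shows "attains_max (worst_case_payoff G u s t \<Gamma>) (flows G u s t)"
  unfolding worst_case_payoff_def
proof (rule attains_max_payoffs[where \<Phi> = "\<lambda>w. Min (w ` interdictions G \<Gamma>)"
      and I = "interdictions G \<Gamma>"])
  show "continuous_on UNIV (\<lambda>w :: ('e \<Rightarrow> nat) \<Rightarrow> real. Min (w ` interdictions G \<Gamma>))"
    by (intro continuous_on_Min_coordinates finite_interdictions interdictions_nonempty assms)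
next
  fix w w' :: "('e \<Rightarrow> nat) \<Rightarrow> real"
  assume w: "\<And>\<mu>. \<mu> \<in> interdictions G \<Gamma> \<Longrightarrow> w \<mu> \<le> w' \<mu>"
  show "Min (w ` interdictions G \<Gamma>) \<le> Min (w' ` interdictions G \<Gamma>)"
    using finite_interdictions interdictions_nonempty[OF assms] w
    by (auto intro!: Min.boundedI intro: order_trans[OF Min_le])
qed

section \<open>Weak duality and the optimal mixed strategy\<close>

text \<open>An average with weights of total mass 1 is at least the smallest payoff.\<close>

lemma worst_case_le_expected_payoff:
  assumes "\<alpha> \<in> distributions (interdictions G \<Gamma>)"
  shows "worst_case_payoff G u s t \<Gamma> x \<le> expected_payoff G u s t \<Gamma> \<alpha> x"
proof -
  have "worst_case_payoff G u s t \<Gamma> x =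
      (\<Sum>\<mu>\<in>interdictions G \<Gamma>. \<alpha> \<mu> * worst_case_payoff G u s t \<Gamma> x)"
    using assms by (simp add: distributions_def sum_distrib_right[symmetric])
  also have "\<dots> \<le> expected_payoff G u s t \<Gamma> \<alpha> x"
    unfolding expected_payoff_def worst_case_payoff_def
    using assms finite_interdictions
    by (intro sum_mono mult_left_mono Min_le) (auto simp: distributions_def PiE_iff)
  finally show ?thesis .
qed

text \<open>Weak duality: an optimal adaptive flow \<open>x\<close> is one possible response to
  \<alpha>, and its expected payoff is at least its worst case.\<close>

lemma Z_ADP_le_best_response:
  assumes "\<Gamma> \<le> card (arcs G)" "\<alpha> \<in> distributions (interdictions G \<Gamma>)"
  shows "Z_ADP G u s t \<Gamma> \<le> best_response_value G u s t \<Gamma> \<alpha>"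
proof -
  obtain x where x: "x \<in> flows G u s t" "Z_ADP G u s t \<Gamma> = worst_case_payoff G u s t \<Gamma> x"
    unfolding Z_ADP_def
    by (rule attains_maxE[OF attains_max_worst_case_payoff[OF assms(1)]])
  obtain y where "\<And>z. z \<in> flows G u s t \<Longrightarrow> expected_payoff G u s t \<Gamma> \<alpha> z \<le> expected_payoff G u s t \<Gamma> \<alpha> y"
    "best_response_value G u s t \<Gamma> \<alpha> = expected_payoff G u s t \<Gamma> \<alpha> y"
    using attains_maxE[OF attains_max_expected_payoff[OF assms(2)]]
    unfolding best_response_value_def by metis
  with x worst_case_le_expected_payoff[OF assms(2), of x] show ?thesis by fastforce
qed

text \<open>Strong duality: no flow has every payoff above \<open>Z_ADP\<close>, so the theorem of
  the alternative with this threshold supplies the weights.\<close>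

lemma optimal_distribution:
  assumes \<Gamma>: "\<Gamma> \<le> card (arcs G)"
  obtains \<alpha> where "\<alpha> \<in> distributions (interdictions G \<Gamma>)"
    "best_response_value G u s t \<Gamma> \<alpha> = Z_ADP G u s t \<Gamma>"
proof -
  let ?\<Omega> = "interdictions G \<Gamma>"
  have "worst_case_payoff G u s t \<Gamma> y \<le> Z_ADP G u s t \<Gamma>" if "y \<in> flows G u s t" for y
    using attains_maxE[OF attains_max_worst_case_payoff[OF \<Gamma>]] that unfolding Z_ADP_def by metis
  then have "\<exists>\<mu>\<in>?\<Omega>. payoff G u s t \<mu> y \<le> Z_ADP G u s t \<Gamma>" if "y \<in> flows G u s t" for y
    using that finite_interdictions interdictions_nonempty[OF \<Gamma>]
    by (simp add: worst_case_payoff_def Min_le_iff)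
  then obtain a where a: "\<forall>\<mu>\<in>?\<Omega>. 0 \<le> a \<mu>" "sum a ?\<Omega> = 1"
    "\<And>y. y \<in> flows G u s t \<Longrightarrow> (\<Sum>\<mu>\<in>?\<Omega>. a \<mu> * payoff G u s t \<mu> y) \<le> Z_ADP G u s t \<Gamma>"
    using concavelike_alternative[of ?\<Omega> "payoff G u s t" "flows G u s t" "Z_ADP G u s t \<Gamma>"]
      finite_interdictions interdictions_nonempty[OF \<Gamma>] concavelike_payoff by blast
  define \<alpha> where "\<alpha> = restrict a ?\<Omega>"
  \<comment> \<open>A nonnegative weight is at most the total mass 1.\<close>
  have "a \<mu> \<le> 1" if "\<mu> \<in> ?\<Omega>" for \<mu>
    using member_le_sum[of \<mu> ?\<Omega> a] a that finite_interdictions by auto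
  then have \<alpha>: "\<alpha> \<in> distributions ?\<Omega>"
    using a by (auto simp: distributions_def \<alpha>_def)
  have "expected_payoff G u s t \<Gamma> \<alpha> y \<le> Z_ADP G u s t \<Gamma>" if "y \<in> flows G u s t" for y
    using a(3)[OF that] by (simp add: expected_payoff_def \<alpha>_def)
  then have "best_response_value G u s t \<Gamma> \<alpha> \<le> Z_ADP G u s t \<Gamma>"
    \<comment> \<open>The zero flow shows that the supremum is over a nonempty set.\<close>
    unfolding best_response_value_def using zero_flow by (intro cSUP_least) auto
  with Z_ADP_le_best_response[OF \<Gamma> \<alpha>] \<alpha> show ?thesis by (intro that[of \<alpha>]) auto
qed

end

theorem theorem1:
  fixes G :: "('v, 'e) pre_digraph" and u :: "'e \<Rightarrow> real" and s t :: 'v and \<Gamma> :: nat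
  assumes "fin_digraph G"
    and "\<forall>e \<in> arcs G. 0 \<le> u e"
    and "s \<in> verts G" and "t \<in> verts G" and "s \<noteq> t"
    and "in_arcs G s = {}" and "out_arcs G t = {}"
    and "1 \<le> \<Gamma>" and "\<Gamma> \<le> card (arcs G)"
  shows "(\<forall>\<mu> \<in> interdictions G \<Gamma>. \<forall>x \<in> flows G u s t.
            attains_max (flow_value G t) (residual_flows G u s t \<mu> x))
       \<and> (\<forall>\<alpha> \<in> distributions (interdictions G \<Gamma>).
            attains_max (expected_payoff G u s t \<Gamma> \<alpha>) (flows G u s t))
       \<and> attains_min (best_response_value G u s t \<Gamma>) (distributions (interdictions G \<Gamma>))
       \<and> attains_max (worst_case_payoff G u s t \<Gamma>) (flows G u s t)
       \<and> Z_RNI G u s t \<Gamma> = Z_ADP G u s t \<Gamma>"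
proof -
  have fin: "finite (arcs G)" using assms(1) by (rule fin_digraph.finite_arcs)
  note u = assms(2) and \<Gamma> = assms(9)
  obtain \<alpha> where \<alpha>: "\<alpha> \<in> distributions (interdictions G \<Gamma>)"
    "best_response_value G u s t \<Gamma> \<alpha> = Z_ADP G u s t \<Gamma>"
    using optimal_distribution[OF fin u \<Gamma>] by blast
  \<comment> \<open>\<open>Z_ADP\<close> bounds every best response value from below, and \<alpha>
    attains it; this gives both the attained minimum and the equality.\<close>
  have le: "Z_ADP G u s t \<Gamma> \<le> best_response_value G u s t \<Gamma> \<beta>"
    if "\<beta> \<in> distributions (interdictions G \<Gamma>)" for \<beta>
    using Z_ADP_le_best_response[OF fin u \<Gamma> that] .
  have "attains_min (best_response_value G u s t \<Gamma>) (distributions (interdictions G \<Gamma>))"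
    using \<alpha> le by (intro attains_minI[of \<alpha>]) auto
  moreover have "Z_RNI G u s t \<Gamma> = Z_ADP G u s t \<Gamma>"
    unfolding Z_RNI_def using \<alpha> le by (intro cInf_eq_minimum) (auto intro: rev_image_eqI)
  ultimately show ?thesis
    using attains_max_residual[OF fin u] attains_max_expected_payoff[OF fin u]
      attains_max_worst_case_payoff[OF fin u \<Gamma>] by blast
qed

end
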